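(* Let $\mu:\mathbb{R}^{<\mathbb{N}}\to\mathbb{R}$ be the mean function on the data universe of all finite-length real-valued vectors. For any chosen parameters $\hat{\mu}\in\mathbb{R}$ and $\Delta\ge 0$, there is a function $g:\mathbb{R}^{<\mathbb{N}}\to\mathbb{R}$ with sensitivity $\Delta$, together with an algorithm that, for any database $D=(x_1,\dots,x_n)\in\mathbb{R}^{<\mathbb{N}}$, computes $g(D)$ in $O(n^2)$ time, such that for every such $D$ \[ |g(D)-\mu(D)| \le \max\left\{|\mu(D)-\hat{\mu}|-\frac{n}{3}\Delta,\,0\right\}+\sum_{i=1}^n\max\left\{\frac{27|x_i-\mu(D)|}{n}-\Delta,\,0\right\}. \] Additionally, if each $x_i\in[\hat{\mu}-\frac{n}{2}\Delta,\ \hat{\mu}+\frac{n}{2}\Delta]$, then $g(D)=\mu(D)$.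
   Context: $\mathbb{R}^{<\mathbb{N}}$ denotes the set of all finite-length real vectors (databases), each entry being the data of one individual; $\mu(D)=\frac1n\sum_i x_i$ for $D=(x_1,\dots,x_n)$. Two databases are neighbors if one is obtained from the other by adding (or removing) a single entry. A function $g$ has sensitivity $\Delta$ if $|g(D)-g(D')|\le\Delta$ for all neighboring $D,D'$. *)

theory Defs
  imports Complex_Main "HOL-Library.Landau_Symbols"
begin

(* A database is a list; the single entry may be inserted at any position. *)
definition neighbors :: "real list \<Rightarrow> real list \<Rightarrow> bool" where
  "neighbors D D' \<longleftrightarrow>
     (\<exists>xs x ys. (D = xs @ ys \<and> D' = xs @ x # ys) \<or> (D = xs @ x # ys \<and> D' = xs @ ys))"

definition has_sensitivity :: "(real list \<Rightarrow> real) \<Rightarrow> real \<Rightarrow> bool" where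
  "has_sensitivity g \<Delta> \<longleftrightarrow> (\<forall>D D'. neighbors D D' \<longrightarrow> \<bar>g D - g D'\<bar> \<le> \<Delta>)"

(* Meaningful only for nonempty D; "mean [] = 0" is an artefact of division by zero. *)
definition mean :: "real list \<Rightarrow> real" where
  "mean D = 1 / real (length D) * (\<Sum>i<length D. D ! i)"

text \<open>
  The usual real RAM of computational geometry, presented as a structured language: exact
  real arithmetic and comparisons at unit cost, and natural-number variables whose only
  role is counting and indexing arrays. There is no rounding and no other conversion from
  reals to naturals (in particular no floor function), no multiplication of naturals, and
  program constants are integers.
\<close>

type_synonym vname = string

datatype nexp = NConst nat | NVar vname | NAdd nexp nexp | NSub nexp nexp

datatype rexp = RConst int | RVar vname | RArr vname nexp
  | RAdd rexp rexp | RSub rexp rexp | RMul rexp rexp | RDiv rexp rexp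

datatype bexp = NLess nexp nexp | RLess rexp rexp | BNot bexp | BAnd bexp bexp

datatype com = Skip
  | NAssign vname nexp
  | RAssign vname rexp
  | AAssign vname nexp rexp
  | Seq com com
  | Cond bexp com com
  | While bexp com

record state =
  nvar :: "vname \<Rightarrow> nat"
  rvar :: "vname \<Rightarrow> real"
  arr :: "vname \<Rightarrow> nat \<Rightarrow> real"

primrec nval :: "nexp \<Rightarrow> state \<Rightarrow> nat" where
  "nval (NConst k) s = k"
| "nval (NVar v) s = nvar s v"
| "nval (NAdd a b) s = nval a s + nval b s"
| "nval (NSub a b) s = nval a s - nval b s"

primrec rval :: "rexp \<Rightarrow> state \<Rightarrow> real" where
  "rval (RConst k) s = of_int k"
| "rval (RVar v) s = rvar s v"
| "rval (RArr v i) s = arr s v (nval i s)"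
| "rval (RAdd a b) s = rval a s + rval b s"
| "rval (RSub a b) s = rval a s - rval b s"
| "rval (RMul a b) s = rval a s * rval b s"
| "rval (RDiv a b) s = rval a s / rval b s"

primrec bval :: "bexp \<Rightarrow> state \<Rightarrow> bool" where
  "bval (NLess a b) s \<longleftrightarrow> nval a s < nval b s"
| "bval (RLess a b) s \<longleftrightarrow> rval a s < rval b s"
| "bval (BNot b) s \<longleftrightarrow> \<not> bval b s"
| "bval (BAnd b c) s \<longleftrightarrow> bval b s \<and> bval c s"

(* Every memory access and every operation in an expression is one step. *)

primrec ncost :: "nexp \<Rightarrow> nat" where
  "ncost (NConst k) = 1"
| "ncost (NVar v) = 1"
| "ncost (NAdd a b) = 1 + ncost a + ncost b"
| "ncost (NSub a b) = 1 + ncost a + ncost b"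

primrec rcost :: "rexp \<Rightarrow> nat" where
  "rcost (RConst k) = 1"
| "rcost (RVar v) = 1"
| "rcost (RArr v i) = 1 + ncost i"
| "rcost (RAdd a b) = 1 + rcost a + rcost b"
| "rcost (RSub a b) = 1 + rcost a + rcost b"
| "rcost (RMul a b) = 1 + rcost a + rcost b"
| "rcost (RDiv a b) = 1 + rcost a + rcost b"

primrec bcost :: "bexp \<Rightarrow> nat" where
  "bcost (NLess a b) = 1 + ncost a + ncost b"
| "bcost (RLess a b) = 1 + rcost a + rcost b"
| "bcost (BNot b) = 1 + bcost b"
| "bcost (BAnd b c) = 1 + bcost b + bcost c"

(* "exec c s t s'": started in s, the command c terminates in s' after exactly t steps. *)
inductive exec :: "com \<Rightarrow> state \<Rightarrow> nat \<Rightarrow> state \<Rightarrow> bool" where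
  Skip: "exec Skip s 1 s"
| NAssign: "exec (NAssign v a) s (1 + ncost a) (s\<lparr>nvar := (nvar s)(v := nval a s)\<rparr>)"
| RAssign: "exec (RAssign v a) s (1 + rcost a) (s\<lparr>rvar := (rvar s)(v := rval a s)\<rparr>)"
| AAssign: "exec (AAssign v i a) s (1 + ncost i + rcost a)
    (s\<lparr>arr := (arr s)(v := (arr s v)(nval i s := rval a s))\<rparr>)"
| Seq: "exec c1 s1 t1 s2 \<Longrightarrow> exec c2 s2 t2 s3 \<Longrightarrow> exec (Seq c1 c2) s1 (t1 + t2) s3"
| CondTrue: "bval b s \<Longrightarrow> exec c1 s t s' \<Longrightarrow> exec (Cond b c1 c2) s (1 + bcost b + t) s'"
| CondFalse: "\<not> bval b s \<Longrightarrow> exec c2 s t s' \<Longrightarrow> exec (Cond b c1 c2) s (1 + bcost b + t) s'"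
| WhileFalse: "\<not> bval b s \<Longrightarrow> exec (While b c) s (1 + bcost b) s"
| WhileTrue: "bval b s1 \<Longrightarrow> exec c s1 t1 s2 \<Longrightarrow> exec (While b c) s2 t2 s3 \<Longrightarrow>
    exec (While b c) s1 (1 + bcost b + t1 + t2) s3"

(* Input convention: the database in array x, its length in n, the two real parameters in
   mu_hat and delta; all other storage is zero. *)
definition input_state :: "real \<Rightarrow> real \<Rightarrow> real list \<Rightarrow> state" where
  "input_state \<mu>' \<Delta> D =
     \<lparr>nvar = (\<lambda>_. 0)(''n'' := length D),
      rvar = (\<lambda>_. 0)(''mu_hat'' := \<mu>', ''delta'' := \<Delta>),
      arr = (\<lambda>_ _. 0)(''x'' := (\<lambda>i. if i < length D then D ! i else 0))\<rparr>"

definition computes_in_time ::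
    "com \<Rightarrow> real \<Rightarrow> real \<Rightarrow> (real list \<Rightarrow> real) \<Rightarrow> (nat \<Rightarrow> nat) \<Rightarrow> bool" where
  "computes_in_time p \<mu>' \<Delta> g T \<longleftrightarrow>
     (\<forall>D. \<exists>t s. exec p (input_state \<mu>' \<Delta> D) t s \<and> rvar s ''result'' = g D \<and> t \<le> T (length D))"

end

theory Submission
  imports Defs
begin

text \<open>
  Clip every entry to the window of half-width \<open>n\<Delta>/2\<close> around \<open>mu_hat\<close> and average. Enlarging
  \<open>n\<close> to \<open>n + 1\<close> changes each of the \<open>n\<close> old contributions by at most \<open>\<Delta>/(2(n + 1))\<close>, and the
  new entry contributes at most \<open>\<Delta>/2\<close>, so the clipped mean has sensitivity \<open>\<Delta>\<close>. Its error
  is at most the average overshoot of the entries beyond the window; an entry can overshoot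
  only as far as the mean exceeds distance \<open>n\<Delta>/3\<close> from \<open>mu_hat\<close> plus as far as the entry exceeds
  distance \<open>n\<Delta>/6\<close> from the mean. A linear-time program computes it.
\<close>

section \<open>Clipping and the sensitivity of the clipped mean\<close>

definition clip :: "real \<Rightarrow> real \<Rightarrow> real" where
  "clip b a = max (- b) (min b a)"

text \<open>On the empty database the quotient is \<open>0 / 0 = 0\<close>, so the value is \<open>\<mu>\<close>, as the sensitivity
  bound for singletons needs.\<close>

definition clipped_mean :: "real \<Rightarrow> real \<Rightarrow> real list \<Rightarrow> real" where
  "clipped_mean \<mu> \<Delta> D =
     \<mu> + (\<Sum>x\<leftarrow>D. clip (real (length D) * \<Delta> / 2) (x - \<mu>)) / real (length D)"

lemma abs_clip_le: "0 \<le> b \<Longrightarrow> \<bar>clip b a\<bar> \<le> b"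
  by (auto simp: clip_def)

lemma abs_clip_diff_le: "0 \<le> b \<Longrightarrow> \<bar>clip b a - a\<bar> \<le> max (\<bar>a\<bar> - b) 0"
  by (auto simp: clip_def)

lemma clip_id: "\<bar>a\<bar> \<le> b \<Longrightarrow> clip b a = a"
  by (auto simp: clip_def)

text \<open>Multiplied by \<open>n * (n + 1)\<close>, the difference becomes
  \<open>n * d - clip p a\<close>. Inside the smaller window \<open>d = 0\<close>; outside it
  \<open>n * d\<close> and \<open>clip p a\<close> lie on the same side of 0 and have size at most
  \<open>p\<close>, so their difference does too.\<close>

lemma clip_rescale_le:
  fixes n c a :: real
  assumes n: "0 < n" and c: "0 \<le> c"
  shows "\<bar>clip ((n + 1) * c) a / (n + 1) - clip (n * c) a / n\<bar> \<le> c / (n + 1)"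
proof -
  define p where "p = n * c"
  have p: "0 \<le> p" using n c by (simp add: p_def)
  define d where "d = clip (p + c) a - clip p a"
  have nd: "0 \<le> n * x \<and> n * x \<le> p" if "0 \<le> x" "x \<le> c" for x
    using that n by (auto simp: p_def)
  have "\<bar>n * d - clip p a\<bar> \<le> p"
  proof (cases "\<bar>a\<bar> \<le> p")
    case True
    then show ?thesis using c p by (simp add: d_def clip_def)
  next
    case False
    show ?thesis
    proof (cases "a > 0")
      case True
      have "0 \<le> d" "d \<le> c" "clip p a = p"
        using True False c p by (auto simp: d_def clip_def)
      then show ?thesis using nd[of d] by auto
    next
      case neg: False
      have "0 \<le> - d" "- d \<le> c" "clip p a = - p"
        using neg False c p by (auto simp: d_def clip_def)
      then show ?thesis using nd[of "- d"] by auto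
    qed
  qed
  moreover have "clip ((n + 1) * c) a / (n + 1) - clip (n * c) a / n
      = (n * d - clip p a) / (n * (n + 1))"
    using n by (simp add: d_def p_def field_simps)
  moreover have "p / (n * (n + 1)) = c / (n + 1)"
    using n by (simp add: p_def)
  ultimately show ?thesis
    using n by (metis abs_divide abs_of_pos add_pos_pos divide_right_mono less_imp_le
        mult_pos_pos zero_less_one)
qed

lemma sum_list_divide:
  fixes f :: "'a \<Rightarrow> real"
  shows "(\<Sum>x\<leftarrow>xs. f x) / a = (\<Sum>x\<leftarrow>xs. f x / a)"
  by (induction xs) (simp_all add: add_divide_distrib)

lemma clipped_mean_insert:
  assumes "0 \<le> \<Delta>"
  shows "\<bar>clipped_mean \<mu> \<Delta> (xs @ x # ys) - clipped_mean \<mu> \<Delta> (xs @ ys)\<bar> \<le> \<Delta>"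
proof -
  define D where "D = xs @ ys"
  define n where "n = real (length D)"
  define c where "c = \<Delta> / 2"
  have c: "0 \<le> c" using assms by (simp add: c_def)
  have n0: "0 \<le> n" by (simp add: n_def)
  define h where "h k y = clip (k * c) (y - \<mu>) / k" for k y
  have old: "\<bar>(\<Sum>y\<leftarrow>D. h (n + 1) y) - (\<Sum>y\<leftarrow>D. h n y)\<bar> \<le> c"
  \<comment> \<open>Rescaling divides by the old length, so insertion into the empty database is
    treated apart.\<close>
  proof (cases "D = []")
    case True
    then show ?thesis using c by simp
  next
    case False
    then have "0 < n" by (simp add: n_def)
    then have "\<bar>h (n + 1) y - h n y\<bar> \<le> c / (n + 1)" for y
      using clip_rescale_le[of n c "y - \<mu>"] c by (simp add: h_def)
    then have "(\<Sum>y\<leftarrow>D. \<bar>h (n + 1) y - h n y\<bar>) \<le> (\<Sum>y\<leftarrow>D. c / (n + 1))"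
      by (intro sum_list_mono)
    also have "\<dots> = n * c / (n + 1)"
      by (simp add: sum_list_triv n_def)
    also have "\<dots> \<le> c"
      using c n0 by (simp add: field_simps)
    finally show ?thesis
      using sum_list_abs[of "map (\<lambda>y. h (n + 1) y - h n y) D"]
      by (simp add: sum_list_subtractf o_def)
  qed
  have new: "\<bar>h (n + 1) x\<bar> \<le> c"
    using abs_clip_le[of "(n + 1) * c" "x - \<mu>"] c n0 by (simp add: h_def field_simps)
  \<comment> \<open>Only sums over entries occur, so the position of the inserted entry is
    irrelevant.\<close>
  have "clipped_mean \<mu> \<Delta> (xs @ x # ys) = \<mu> + (\<Sum>y\<leftarrow>D. h (n + 1) y) + h (n + 1) x"
    by (simp add: clipped_mean_def D_def h_def n_def c_def add_divide_distrib
        sum_list_divide algebra_simps)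
  moreover have "clipped_mean \<mu> \<Delta> (xs @ ys) = \<mu> + (\<Sum>y\<leftarrow>D. h n y)"
    by (simp add: clipped_mean_def D_def h_def n_def c_def add_divide_distrib
        sum_list_divide)
  ultimately show ?thesis
    using old new unfolding c_def by linarith
qed

lemma has_sensitivity_clipped_mean:
  assumes "0 \<le> \<Delta>"
  shows "has_sensitivity (clipped_mean \<mu> \<Delta>) \<Delta>"
  unfolding has_sensitivity_def neighbors_def
  using clipped_mean_insert[OF assms] by (auto simp: abs_minus_commute)

section \<open>Accuracy\<close>

text \<open>Averaging the deviations from \<open>\<mu>\<close> gives \<open>mean D - \<mu>\<close>,
  provided \<open>D\<close> is nonempty. The estimates below can then be made entry by
  entry.\<close>

lemma clipped_mean_error:
  assumes "D \<noteq> []"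
  shows "clipped_mean \<mu> \<Delta> D - mean D =
    (\<Sum>i<length D. clip (real (length D) * \<Delta> / 2) (D ! i - \<mu>) - (D ! i - \<mu>)) / real (length D)"
  using assms
  by (simp add: clipped_mean_def mean_def sum_list_sum_nth atLeast0LessThan sum_subtractf sum.distrib field_simps)

lemma abs_clipped_mean_error_le:
  assumes "0 \<le> \<Delta>" and "D \<noteq> []"
  shows "\<bar>clipped_mean \<mu> \<Delta> D - mean D\<bar>
    \<le> max (\<bar>mean D - \<mu>\<bar> - real (length D) / 3 * \<Delta>) 0
      + (\<Sum>i<length D. max (27 * \<bar>D ! i - mean D\<bar> / real (length D) - \<Delta>) 0)"
proof -
  define n where "n = real (length D)"
  have n: "0 < n" using assms by (simp add: n_def)
  define e where "e = max (\<bar>mean D - \<mu>\<bar> - n / 3 * \<Delta>) 0"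
  define r where "r i = max (27 * \<bar>D ! i - mean D\<bar> / n - \<Delta>) 0" for i
  have overshoot: "\<bar>clip (n * \<Delta> / 2) (D ! i - \<mu>) - (D ! i - \<mu>)\<bar> \<le> e + n * r i" for i
  proof -
    define a where "a = \<bar>D ! i - mean D\<bar>"
    have nr: "n * r i = max (27 * a - n * \<Delta>) 0"
      using n by (simp add: r_def a_def max_mult_distrib_left algebra_simps)
    have p: "0 \<le> n * \<Delta>" using n assms by simp
    have "\<bar>D ! i - \<mu>\<bar> \<le> a + \<bar>mean D - \<mu>\<bar>" by (simp add: a_def)
    moreover have "\<bar>mean D - \<mu>\<bar> \<le> e + n * \<Delta> / 3" by (simp add: e_def)
    moreover have "0 \<le> e" by (simp add: e_def)
    moreover have "0 \<le> a" by (simp add: a_def)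
    \<comment> \<open>With \<open>p = n * \<Delta>\<close>, the overshoot is at most
      \<open>e + a - p / 6\<close>, as \<open>1/2 - 1/3 = 1/6\<close>. Finally
      \<open>a - p / 6 \<le> max (6 * a - p) 0\<close>, so any factor of at least 6 in place of 27
      would do.\<close>
    ultimately have "max (\<bar>D ! i - \<mu>\<bar> - n * \<Delta> / 2) 0 \<le> e + n * r i"
      unfolding nr using p by linarith
    then show ?thesis
      using abs_clip_diff_le[of "n * \<Delta> / 2" "D ! i - \<mu>"] p by linarith
  qed
  have "\<bar>\<Sum>i<length D. clip (n * \<Delta> / 2) (D ! i - \<mu>) - (D ! i - \<mu>)\<bar> \<le> (\<Sum>i<length D. e + n * r i)"
    by (rule order_trans[OF sum_abs sum_mono[OF overshoot]])
  \<comment> \<open>Division by \<open>n\<close> now turns \<open>e\<close> into a single term and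
    leaves the \<open>r i\<close> summed rather than averaged.\<close>
  also have "\<dots> = n * (e + (\<Sum>i<length D. r i))"
    by (simp add: sum.distrib sum_distrib_left n_def algebra_simps)
  finally have "\<bar>clipped_mean \<mu> \<Delta> D - mean D\<bar> \<le> e + (\<Sum>i<length D. r i)"
    using n unfolding clipped_mean_error[OF assms(2)] n_def[symmetric]
    by (simp add: divide_le_eq mult.commute)
  then show ?thesis by (simp add: e_def r_def n_def)
qed

lemma clipped_mean_eq_mean:
  assumes "D \<noteq> []"
    and "\<forall>i<length D. D ! i \<in> {\<mu> - real (length D) / 2 * \<Delta> .. \<mu> + real (length D) / 2 * \<Delta>}"
  shows "clipped_mean \<mu> \<Delta> D = mean D"
proof -
  have "clip (real (length D) * \<Delta> / 2) (D ! i - \<mu>) = D ! i - \<mu>" if "i < length D" for i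
  proof (rule clip_id)
    have "D ! i \<in> {\<mu> - real (length D) / 2 * \<Delta> .. \<mu> + real (length D) / 2 * \<Delta>}"
      using assms(2) that by blast
    then show "\<bar>D ! i - \<mu>\<bar> \<le> real (length D) * \<Delta> / 2"
      by (simp only: atLeastAtMost_iff times_divide_eq_left) linarith
  qed
  then show ?thesis
    using clipped_mean_error[OF assms(1), of \<mu> \<Delta>] by simp
qed

section \<open>Hoare-style rules with time bounds\<close>

text \<open>A total-correctness judgement with an upper bound on time, so that branches of different
  cost can share one bound.\<close>

definition runs_within :: "com \<Rightarrow> state \<Rightarrow> nat \<Rightarrow> (state \<Rightarrow> bool) \<Rightarrow> bool" where
  "runs_within c s T Q \<longleftrightarrow> (\<exists>t s'. exec c s t s' \<and> t \<le> T \<and> Q s')"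

lemma runs_within_Skip: "Q s \<Longrightarrow> runs_within Skip s 1 Q"
  unfolding runs_within_def by (blast intro: exec.Skip)

lemma runs_within_NAssign:
  "Q (s\<lparr>nvar := (nvar s)(v := nval a s)\<rparr>) \<Longrightarrow> runs_within (NAssign v a) s (1 + ncost a) Q"
  unfolding runs_within_def by (blast intro: exec.NAssign)

lemma runs_within_RAssign:
  "Q (s\<lparr>rvar := (rvar s)(v := rval a s)\<rparr>) \<Longrightarrow> runs_within (RAssign v a) s (1 + rcost a) Q"
  unfolding runs_within_def by (blast intro: exec.RAssign)

lemma runs_within_Seq:
  assumes "runs_within c1 s T1 P" and "\<And>s'. P s' \<Longrightarrow> runs_within c2 s' T2 Q"
  shows "runs_within (Seq c1 c2) s (T1 + T2) Q"
  using assms unfolding runs_within_def by (meson add_mono exec.Seq)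

lemma runs_within_Cond:
  assumes "bval b s \<Longrightarrow> runs_within c1 s T1 Q" and "\<not> bval b s \<Longrightarrow> runs_within c2 s T2 Q"
  shows "runs_within (Cond b c1 c2) s (1 + bcost b + max T1 T2) Q"
proof (cases "bval b s")
  case True
  with assms(1) obtain t s' where "exec c1 s t s'" "t \<le> T1" "Q s'"
    by (auto simp: runs_within_def)
  then show ?thesis
    using exec.CondTrue[OF True] unfolding runs_within_def
    by (meson add_left_mono le_max_iff_disj)
next
  case False
  with assms(2) obtain t s' where "exec c2 s t s'" "t \<le> T2" "Q s'"
    by (auto simp: runs_within_def)
  then show ?thesis
    using exec.CondFalse[OF False] unfolding runs_within_def
    by (meson add_left_mono le_max_iff_disj)
qed

text \<open>Here \<open>k\<close> counts completed iterations: \<open>n - k\<close> rounds of guard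
  and body remain, then one failing guard test. The induction descends from
  \<open>k = n\<close>.\<close>

lemma runs_within_While:
  assumes "I k s" and "k \<le> n"
    and step: "\<And>k s. I k s \<Longrightarrow> k < n \<Longrightarrow> bval b s \<and> runs_within c s T (I (Suc k))"
    and stop: "\<And>s. I n s \<Longrightarrow> \<not> bval b s"
  shows "runs_within (While b c) s ((n - k) * (1 + bcost b + T) + (1 + bcost b)) (I n)"
  using assms(2,1)
proof (induction arbitrary: s rule: inc_induct)
  case base
  then show ?case
    using exec.WhileFalse[OF stop[OF base]] unfolding runs_within_def by auto
next
  case (step k)
  from assms(3)[OF step.prems step.hyps(2)]
  obtain t1 s1 where b: "bval b s" and c: "exec c s t1 s1" "t1 \<le> T" "I (Suc k) s1"
    by (auto simp: runs_within_def)
  from step.IH[OF c(3)] obtain t2 s2 where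
    w: "exec (While b c) s1 t2 s2" "t2 \<le> (n - Suc k) * (1 + bcost b + T) + (1 + bcost b)" "I n s2"
    by (auto simp: runs_within_def)
  have "n - k = Suc (n - Suc k)" using step.hyps by simp
  then have "1 + bcost b + t1 + t2 \<le> (n - k) * (1 + bcost b + T) + (1 + bcost b)"
    using c(2) w(2) by simp
  with exec.WhileTrue[OF b c(1) w(1)] w(3) show ?case
    unfolding runs_within_def by blast
qed

lemma runs_within_mono:
  "runs_within c s T P \<Longrightarrow> T \<le> T' \<Longrightarrow> (\<And>s. P s \<Longrightarrow> Q s) \<Longrightarrow> runs_within c s T' Q"
  unfolding runs_within_def by (meson order_trans)

section \<open>The program and its correctness\<close>

text \<open>The language cannot convert a natural number to a real, so a first loop counts the length
  in a real variable.\<close>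

definition count_body :: com where
  "count_body = Seq (RAssign ''m'' (RAdd (RVar ''m'') (RConst 1)))
    (NAssign ''i'' (NAdd (NVar ''i'') (NConst 1)))"

text \<open>With no minimum, maximum or negation available, one conditional caps \<open>a\<close> at
  \<open>h\<close> and the next raises it to \<open>0 - h\<close>.\<close>

definition clip_body :: com where
  "clip_body =
    Seq (RAssign ''a'' (RSub (RArr ''x'' (NVar ''j'')) (RVar ''mu_hat'')))
    (Seq (Cond (RLess (RVar ''h'') (RVar ''a'')) (RAssign ''a'' (RVar ''h'')) Skip)
    (Seq (Cond (RLess (RVar ''a'') (RSub (RConst 0) (RVar ''h'')))
            (RAssign ''a'' (RSub (RConst 0) (RVar ''h''))) Skip)
    (Seq (RAssign ''s'' (RAdd (RVar ''s'') (RVar ''a'')))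
      (NAssign ''j'' (NAdd (NVar ''j'') (NConst 1))))))"

definition clipped_mean_prog :: com where
  "clipped_mean_prog =
    Seq (While (NLess (NVar ''i'') (NVar ''n'')) count_body)
    (Seq (RAssign ''h'' (RDiv (RMul (RVar ''m'') (RVar ''delta'')) (RConst 2)))
    (Seq (While (NLess (NVar ''j'') (NVar ''n'')) clip_body)
      (RAssign ''result'' (RAdd (RVar ''mu_hat'') (RDiv (RVar ''s'') (RVar ''m''))))))"

text \<open>The zero values of \<open>j\<close> and \<open>s\<close> are carried along to start the
  second loop.\<close>

definition count_inv :: "real \<Rightarrow> real \<Rightarrow> real list \<Rightarrow> nat \<Rightarrow> state \<Rightarrow> bool" where
  "count_inv \<mu> \<Delta> D k s \<longleftrightarrow>
     nvar s ''i'' = k \<and> nvar s ''j'' = 0 \<and> nvar s ''n'' = length D \<and>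
     rvar s ''m'' = real k \<and> rvar s ''s'' = 0 \<and>
     rvar s ''mu_hat'' = \<mu> \<and> rvar s ''delta'' = \<Delta> \<and>
     (\<forall>i<length D. arr s ''x'' i = D ! i)"

definition clip_inv :: "real \<Rightarrow> real \<Rightarrow> real list \<Rightarrow> nat \<Rightarrow> state \<Rightarrow> bool" where
  "clip_inv \<mu> \<Delta> D k s \<longleftrightarrow>
     nvar s ''j'' = k \<and> nvar s ''n'' = length D \<and>
     rvar s ''m'' = real (length D) \<and> rvar s ''h'' = real (length D) * \<Delta> / 2 \<and>
     rvar s ''s'' = (\<Sum>i<k. clip (real (length D) * \<Delta> / 2) (D ! i - \<mu>)) \<and>
     rvar s ''mu_hat'' = \<mu> \<and> (\<forall>i<length D. arr s ''x'' i = D ! i)"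

lemma count_body_correct:
  assumes "count_inv \<mu> \<Delta> D k s"
  shows "runs_within count_body s 8 (count_inv \<mu> \<Delta> D (Suc k))"
  unfolding count_body_def
  by (rule runs_within_mono, rule runs_within_Seq,
      rule runs_within_RAssign[where Q = "\<lambda>s'. s' = _"], rule refl,
      rule runs_within_NAssign[where Q = "count_inv \<mu> \<Delta> D (Suc k)"])
    (use assms in \<open>simp_all add: count_inv_def\<close>)

lemma clip_body_correct:
  assumes "0 \<le> \<Delta>" and inv: "clip_inv \<mu> \<Delta> D k s" and "k < length D"
  shows "runs_within clip_body s 33 (clip_inv \<mu> \<Delta> D (Suc k))"
proof -
  define b where "b = real (length D) * \<Delta> / 2"
  have b: "0 \<le> b" using assms by (simp add: b_def)
  have clip: "clip b (D ! k - \<mu>) =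
      (if min b (D ! k - \<mu>) < - b then - b else min b (D ! k - \<mu>))"
    by (auto simp: clip_def)
  \<comment> \<open>\<open>f\<close> records what has been done to the current deviation: nothing,
    \<open>min b\<close>, then \<open>clip b\<close>. Writing to \<open>a\<close> preserves
    \<open>clip_inv\<close>, which does not mention it.\<close>
  define P where "P f s' \<longleftrightarrow> clip_inv \<mu> \<Delta> D k s' \<and> rvar s' ''a'' = f (D ! k - \<mu>)"
    for f s'
  have 1: "runs_within (RAssign ''a'' (RSub (RArr ''x'' (NVar ''j'')) (RVar ''mu_hat''))) s
      (1 + rcost (RSub (RArr ''x'' (NVar ''j'')) (RVar ''mu_hat''))) (P (\<lambda>a. a))"
    by (rule runs_within_RAssign) (use inv assms(3) in \<open>simp add: P_def clip_inv_def\<close>)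
  have 2: "runs_within (Cond (RLess (RVar ''h'') (RVar ''a'')) (RAssign ''a'' (RVar ''h'')) Skip) s'
      (1 + bcost (RLess (RVar ''h'') (RVar ''a'')) + max (1 + rcost (RVar ''h'')) 1) (P (min b))"
    if "P (\<lambda>a. a) s'" for s'
    by (rule runs_within_Cond, rule runs_within_RAssign, use that in \<open>simp add: P_def clip_inv_def b_def\<close>,
        rule runs_within_Skip, use that in \<open>simp add: P_def clip_inv_def b_def\<close>)
  have 3: "runs_within (Cond (RLess (RVar ''a'') (RSub (RConst 0) (RVar ''h'')))
            (RAssign ''a'' (RSub (RConst 0) (RVar ''h''))) Skip) s'
      (1 + bcost (RLess (RVar ''a'') (RSub (RConst 0) (RVar ''h'')))
        + max (1 + rcost (RSub (RConst 0) (RVar ''h''))) 1) (P (clip b))"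
    if "P (min b) s'" for s'
    by (rule runs_within_Cond, rule runs_within_RAssign, use that clip in \<open>simp add: P_def clip_inv_def flip: b_def\<close>,
        rule runs_within_Skip, use that clip in \<open>simp add: P_def clip_inv_def flip: b_def\<close>)
  \<comment> \<open>Between the updates of \<open>s\<close> and \<open>j\<close> the invariant
    fails, so it is asserted of the state after the pending increment.\<close>
  have 4: "runs_within (RAssign ''s'' (RAdd (RVar ''s'') (RVar ''a''))) s'
      (1 + rcost (RAdd (RVar ''s'') (RVar ''a'')))
      (\<lambda>s. clip_inv \<mu> \<Delta> D (Suc k) (s\<lparr>nvar := (nvar s)(''j'' := nvar s ''j'' + 1)\<rparr>))"
    if "P (clip b) s'" for s'
    by (rule runs_within_RAssign) (use that in \<open>simp add: P_def clip_inv_def b_def\<close>)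
  have 5: "runs_within (NAssign ''j'' (NAdd (NVar ''j'') (NConst 1))) s'
      (1 + ncost (NAdd (NVar ''j'') (NConst 1))) (clip_inv \<mu> \<Delta> D (Suc k))"
    if "clip_inv \<mu> \<Delta> D (Suc k) (s'\<lparr>nvar := (nvar s')(''j'' := nvar s' ''j'' + 1)\<rparr>)" for s'
    by (rule runs_within_NAssign) (use that in simp)
  \<comment> \<open>The bounds sum to \<open>5 + 6 + 10 + 4 + 4 = 29\<close>, within 33.\<close>
  show ?thesis
    unfolding clip_body_def
    by (rule runs_within_mono, rule runs_within_Seq[OF 1], rule runs_within_Seq[OF 2], assumption,
        rule runs_within_Seq[OF 3], assumption, rule runs_within_Seq[OF 4], assumption, rule 5)
      simp_all
qed

lemma clipped_mean_prog_correct: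
  assumes "0 \<le> \<Delta>"
  shows "runs_within clipped_mean_prog (input_state \<mu> \<Delta> D) (49 * length D + 21)
    (\<lambda>s. rvar s ''result'' = clipped_mean \<mu> \<Delta> D)"
proof -
  let ?n = "length D"
  let ?b1 = "NLess (NVar ''i'') (NVar ''n'')" and ?b2 = "NLess (NVar ''j'') (NVar ''n'')"
  have 1: "runs_within (While ?b1 count_body) (input_state \<mu> \<Delta> D)
      ((?n - 0) * (1 + bcost ?b1 + 8) + (1 + bcost ?b1)) (count_inv \<mu> \<Delta> D ?n)"
  proof (rule runs_within_While)
    show "count_inv \<mu> \<Delta> D 0 (input_state \<mu> \<Delta> D)"
      by (simp add: count_inv_def input_state_def)
  qed (auto simp: count_body_correct, auto simp: count_inv_def)
  have 2: "runs_within (RAssign ''h'' (RDiv (RMul (RVar ''m'') (RVar ''delta'')) (RConst 2))) s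
      (1 + rcost (RDiv (RMul (RVar ''m'') (RVar ''delta'')) (RConst 2))) (clip_inv \<mu> \<Delta> D 0)"
    if "count_inv \<mu> \<Delta> D ?n s" for s
    by (rule runs_within_RAssign) (use that in \<open>simp add: count_inv_def clip_inv_def\<close>)
  have 3: "runs_within (While ?b2 clip_body) s
      ((?n - 0) * (1 + bcost ?b2 + 33) + (1 + bcost ?b2)) (clip_inv \<mu> \<Delta> D ?n)"
    if "clip_inv \<mu> \<Delta> D 0 s" for s
    by (rule runs_within_While[where I = "clip_inv \<mu> \<Delta> D", OF that])
      (auto simp: clip_body_correct[OF assms], auto simp: clip_inv_def)
  have 4: "runs_within (RAssign ''result'' (RAdd (RVar ''mu_hat'') (RDiv (RVar ''s'') (RVar ''m'')))) s
      (1 + rcost (RAdd (RVar ''mu_hat'') (RDiv (RVar ''s'') (RVar ''m''))))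
      (\<lambda>s. rvar s ''result'' = clipped_mean \<mu> \<Delta> D)"
    if "clip_inv \<mu> \<Delta> D ?n s" for s
    by (rule runs_within_RAssign)
      (use that in \<open>simp add: clip_inv_def clipped_mean_def sum_list_sum_nth atLeast0LessThan\<close>)
  \<comment> \<open>Per entry, the loops cost \<open>(4 + 8) + (4 + 33) = 49\<close>; the two
    failing guards and two assignments cost \<open>4 + 4 + 6 + 6 = 20\<close>.\<close>
  show ?thesis
    unfolding clipped_mean_prog_def
    by (rule runs_within_mono, rule runs_within_Seq[OF 1], rule runs_within_Seq[OF 2], assumption,
        rule runs_within_Seq[OF 3], assumption, rule 4)
      simp_all
qed

lemma linear_in_bigo_square: "(\<lambda>n. real (a * n + b)) \<in> O(\<lambda>n. real n ^ 2)"
proof (rule bigoI)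
  show "\<forall>\<^sub>F n in sequentially. norm (real (a * n + b)) \<le> real (a + b) * norm (real n ^ 2)"
    using eventually_ge_at_top[of 1]
  proof eventually_elim
    case (elim n)
    \<comment> \<open>For \<open>n \<ge> 1\<close> both \<open>n\<close> and 1 are at most
      \<open>n^2\<close>.\<close>
    then have "a * n + b \<le> a * n^2 + b * n^2"
      by (intro add_mono) (simp_all add: power2_eq_square)
    then have "real (a * n + b) \<le> real (a * n^2 + b * n^2)"
      by (simp only: of_nat_le_iff)
    then show ?case by (simp add: algebra_simps)
  qed
qed

theorem theorem1p6:
  fixes mu_hat \<Delta> :: real
  assumes "\<Delta> \<ge> 0"
  shows "\<exists>g :: real list \<Rightarrow> real.
    has_sensitivity g \<Delta> \<and>
    (\<exists>p T. computes_in_time p mu_hat \<Delta> g T \<and> (\<lambda>n. real (T n)) \<in> O(\<lambda>n. real n ^ 2)) \<and>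
    (\<forall>D. D \<noteq> [] \<longrightarrow>
      \<bar>g D - mean D\<bar>
        \<le> max (\<bar>mean D - mu_hat\<bar> - real (length D) / 3 * \<Delta>) 0
          + (\<Sum>i<length D. max (27 * \<bar>D ! i - mean D\<bar> / real (length D) - \<Delta>) 0)) \<and>
    (\<forall>D. D \<noteq> [] \<longrightarrow>
      (\<forall>i<length D. D ! i \<in> {mu_hat - real (length D) / 2 * \<Delta> .. mu_hat + real (length D) / 2 * \<Delta>}) \<longrightarrow>
      g D = mean D)"
proof (intro exI[of _ "clipped_mean mu_hat \<Delta>"] conjI allI impI)
  \<comment> \<open>One program serves all parameters, which it reads from the input state.\<close>
  have "computes_in_time clipped_mean_prog mu_hat \<Delta> (clipped_mean mu_hat \<Delta>) (\<lambda>n. 49 * n + 21)"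
    using clipped_mean_prog_correct[OF assms]
    unfolding computes_in_time_def runs_within_def by blast
  then show "\<exists>p T. computes_in_time p mu_hat \<Delta> (clipped_mean mu_hat \<Delta>) T \<and>
      (\<lambda>n. real (T n)) \<in> O(\<lambda>n. real n ^ 2)"
    using linear_in_bigo_square by blast
qed (fact has_sensitivity_clipped_mean[OF assms] abs_clipped_mean_error_le[OF assms]
    | rule clipped_mean_eq_mean, assumption, assumption)+

end
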